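(* Let $(A,\mu_1,\mu_2,\delta_1,\delta_2)$ be a compatible AssDer pair, and put $w_1=\mu_1$, $w_2=\mu_2$. For $n\ge1$ let $\mathcal{C}^n_{\mathrm{C.A.D}}(A,A)$ be the direct sum of $n$ copies of $C^n_{\mathrm{AssDer}}(A,A)$, and define $d^n_{\mathrm{C.A.D}}:\mathcal{C}^n_{\mathrm{C.A.D}}(A,A)\to\mathcal{C}^{n+1}_{\mathrm{C.A.D}}(A,A)$ as follows. For $n=1$ and $f\in\mathrm{Hom}(A,A)$, $$d^1_{\mathrm{C.A.D}}(f)=\big(([w_1,f]_G,-[f,\delta_1]_G),([w_2,f]_G,-[f,\delta_2]_G)\big).$$ For $n\ge2$, $d^n_{\mathrm{C.A.D}}\big((f^1,g^1),\ldots,(f^n,g^n)\big)$ is $(-1)^{n-1}$ times the $(n+1)$-tuple whose first entry is $$([w_1,f^1]_G,\,-[w_1,g^1]_G-[f^1,\delta_1]_G),$$ whose $i$-th entry for $2\le i\le n$ is $$([w_2,f^{i-1}]_G+[w_1,f^i]_G,\,-[w_2,g^{i-1}]_G-[w_1,g^i]_G-[f^{i-1},\delta_2]_G-[f^i,\delta_1]_G),$$ and whose $(n+1)$-st entry is $$([w_2,f^n]_G,\,-[w_2,g^n]_G-[f^n,\delta_2]_G).$$ Then $d^{\ast}_{\mathrm{C.A.D}}$ is a coboundary operator, i.e. $d^{n+1}_{\mathrm{C.A.D}}\circ d^n_{\mathrm{C.A.D}}=0$ for all $n\ge1$.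
   Context: All vector spaces are over a field $\mathbb{K}$ of characteristic $0$. An AssDer pair $(A,\mu,\delta)$ is an associative algebra $(A,\mu)$ with a linear map $\delta:A\to A$ such that $\delta\mu(x,y)=\mu(\delta x,y)+\mu(x,\delta y)$. A compatible AssDer pair $(A,\mu_1,\mu_2,\delta_1,\delta_2)$ consists of two AssDer pairs $(A,\mu_1,\delta_1)$, $(A,\mu_2,\delta_2)$ such that for all $x,y,z\in A$: $\mu_2(\mu_1(x,y),z)+\mu_1(\mu_2(x,y),z)=\mu_1(x,\mu_2(y,z))+\mu_2(x,\mu_1(y,z))$ and $\delta_1(\mu_2(x,y))+\delta_2(\mu_1(x,y))=\mu_2(\delta_1x,y)+\mu_2(x,\delta_1y)+\mu_1(\delta_2x,y)+\mu_1(x,\delta_2y)$. Let $C^n(A,A)=\mathrm{Hom}(A^{\otimes n},A)$. For $f\in C^{p+1}(A,A)$, $g\in C^{q+1}(A,A)$ the Gerstenhaber bracket is $[f,g]_G=f\circ g-(-1)^{pq}g\circ f$, where $(f\circ g)(x_1,\ldots,x_{p+q+1})=\sum_{i=1}^{p+1}(-1)^{(i-1)q}f(x_1,\ldots,x_{i-1},g(x_i,\ldots,x_{i+q}),\ldots,x_{p+q+1})$. The spaces are $C^1_{\mathrm{AssDer}}(A,A)=\mathrm{Hom}(A,A)$ and $C^n_{\mathrm{AssDer}}(A,A)=C^n(A,A)\oplus C^{n-1}(A,A)$ for $n\ge2$. The space of $0$-cochains is $0$. *)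

theory Defs
  imports HOL.Vector_Spaces "HOL-Library.Function_Algebras" "HOL-Library.Product_Plus"
begin

text \<open>
  An \<open>n\<close>-cochain, i.e. an element of \<open>Hom(A\<^sup>\<otimes>\<^sup>n, A)\<close>, is represented by the corresponding
  \<open>n\<close>-linear map, taking its arguments as a list of length \<open>n\<close>; on lists of any other length it is
  required to be \<open>0\<close>, so that equality of cochains is equality of functions.
\<close>

type_synonym 'a cochain = "'a list \<Rightarrow> 'a"

definition cochain1 :: "('a \<Rightarrow> 'a) \<Rightarrow> 'a::zero cochain" where
  "cochain1 \<delta> = (\<lambda>xs. case xs of [x] \<Rightarrow> \<delta> x | _ \<Rightarrow> 0)"

definition cochain2 :: "('a \<Rightarrow> 'a \<Rightarrow> 'a) \<Rightarrow> 'a::zero cochain" where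
  "cochain2 \<mu> = (\<lambda>xs. case xs of [x, y] \<Rightarrow> \<mu> x y | _ \<Rightarrow> 0)"

locale char0_vector_space = vector_space scale
  for scale :: "'k::field_char_0 \<Rightarrow> 'a::ab_group_add \<Rightarrow> 'a"
begin

definition cochains :: "nat \<Rightarrow> 'a cochain set" where
  "cochains n = {f.
     (\<forall>xs. length xs \<noteq> n \<longrightarrow> f xs = 0) \<and>
     (\<forall>xs ys. length xs + 1 + length ys = n \<longrightarrow>
        Vector_Spaces.linear scale scale (\<lambda>x. f (xs @ [x] @ ys)))}"

definition cscale :: "'k \<Rightarrow> 'a cochain \<Rightarrow> 'a cochain" where
  "cscale a f = (\<lambda>xs. scale a (f xs))"

text \<open>
  In \<open>circ p q f g\<close> and \<open>bracket p q f g\<close> the numbers \<open>p\<close> and \<open>q\<close> are the degrees of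
  \<open>f \<in> cochains (p + 1)\<close> and \<open>g \<in> cochains (q + 1)\<close>, i.e. their arities minus one.
\<close>

definition circ :: "nat \<Rightarrow> nat \<Rightarrow> 'a cochain \<Rightarrow> 'a cochain \<Rightarrow> 'a cochain" where
  "circ p q f g = (\<lambda>xs. if length xs = p + q + 1
     then \<Sum>i = 1..p + 1. scale ((-1) ^ ((i - 1) * q))
            (f (take (i - 1) xs @ [g (take (q + 1) (drop (i - 1) xs))] @ drop (i + q) xs))
     else 0)"

definition bracket :: "nat \<Rightarrow> nat \<Rightarrow> 'a cochain \<Rightarrow> 'a cochain \<Rightarrow> 'a cochain" where
  "bracket p q f g = circ p q f g - cscale ((-1) ^ (p * q)) (circ q p g f)"

text \<open>\<open>Hom(A, A)\<close>, the space in degree \<open>1\<close>, is identified with \<open>Hom(A, A) \<oplus> 0\<close>.\<close>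

definition AssDer_cochains :: "nat \<Rightarrow> ('a cochain \<times> 'a cochain) set" where
  "AssDer_cochains n =
     (if n = 0 then {0}
      else if n = 1 then cochains 1 \<times> {0}
      else cochains n \<times> cochains (n - 1))"

text \<open>
  An \<open>n\<close>-tuple is a function on the index set \<open>{1..n}\<close>, extended by \<open>0\<close> to \<^typ>\<open>nat\<close>.
\<close>

definition CAD_cochains :: "nat \<Rightarrow> (nat \<Rightarrow> 'a cochain \<times> 'a cochain) set" where
  "CAD_cochains n =
     {c. (\<forall>i \<in> {1..n}. c i \<in> AssDer_cochains n) \<and> (\<forall>i. i \<notin> {1..n} \<longrightarrow> c i = 0)}"

end

locale AssDer_pair = char0_vector_space scale
  for scale :: "'k::field_char_0 \<Rightarrow> 'a::ab_group_add \<Rightarrow> 'a" +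
  fixes \<mu> :: "'a \<Rightarrow> 'a \<Rightarrow> 'a" and \<delta> :: "'a \<Rightarrow> 'a"
  assumes linear_mult_left: "Vector_Spaces.linear scale scale (\<lambda>x. \<mu> x y)"
    and linear_mult_right: "Vector_Spaces.linear scale scale (\<lambda>y. \<mu> x y)"
    and assoc: "\<mu> (\<mu> x y) z = \<mu> x (\<mu> y z)"
    and linear_der: "Vector_Spaces.linear scale scale \<delta>"
    and Leibniz: "\<delta> (\<mu> x y) = \<mu> (\<delta> x) y + \<mu> x (\<delta> y)"

locale compatible_AssDer_pair =
  char0_vector_space scale +
  P1: AssDer_pair scale \<mu>1 \<delta>1 +
  P2: AssDer_pair scale \<mu>2 \<delta>2
  for scale :: "'k::field_char_0 \<Rightarrow> 'a::ab_group_add \<Rightarrow> 'a"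
    and \<mu>1 \<mu>2 :: "'a \<Rightarrow> 'a \<Rightarrow> 'a" and \<delta>1 \<delta>2 :: "'a \<Rightarrow> 'a" +
  assumes compatible_mult:
    "\<mu>2 (\<mu>1 x y) z + \<mu>1 (\<mu>2 x y) z = \<mu>1 x (\<mu>2 y z) + \<mu>2 x (\<mu>1 y z)"
    and compatible_der:
    "\<delta>1 (\<mu>2 x y) + \<delta>2 (\<mu>1 x y) =
       \<mu>2 (\<delta>1 x) y + \<mu>2 x (\<delta>1 y) + \<mu>1 (\<delta>2 x) y + \<mu>1 x (\<delta>2 y)"
begin

abbreviation w1 :: "'a cochain" where "w1 \<equiv> cochain2 \<mu>1"
abbreviation w2 :: "'a cochain" where "w2 \<equiv> cochain2 \<mu>2"
abbreviation D1 :: "'a cochain" where "D1 \<equiv> cochain1 \<delta>1"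
abbreviation D2 :: "'a cochain" where "D2 \<equiv> cochain1 \<delta>2"

text \<open>
  In degree \<open>1\<close> the second component \<open>snd (c 1)\<close> of an element of \<^term>\<open>CAD_cochains 1\<close> is \<open>0\<close> and
  is ignored. In degree \<open>n \<ge> 2\<close>, the maps \<open>f i\<close> have arity \<open>n\<close> and the maps \<open>g i\<close> arity \<open>n - 1\<close>,
  hence degrees \<open>n - 1\<close> and \<open>n - 2\<close>.
\<close>

definition d_CAD ::
  "nat \<Rightarrow> (nat \<Rightarrow> 'a cochain \<times> 'a cochain) \<Rightarrow> (nat \<Rightarrow> 'a cochain \<times> 'a cochain)" where
  "d_CAD n c =
    (let f = (\<lambda>i. fst (c i)); g = (\<lambda>i. snd (c i)) in
     if n = 1 then
       (\<lambda>i. if i = 1 then (bracket 1 0 w1 (f 1), - bracket 0 0 (f 1) D1)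
            else if i = 2 then (bracket 1 0 w2 (f 1), - bracket 0 0 (f 1) D2)
            else 0)
     else
       (\<lambda>i. map_prod (cscale ((-1) ^ (n - 1))) (cscale ((-1) ^ (n - 1)))
         (if i = 1 then
            (bracket 1 (n - 1) w1 (f 1),
             - bracket 1 (n - 2) w1 (g 1) - bracket (n - 1) 0 (f 1) D1)
          else if 2 \<le> i \<and> i \<le> n then
            (bracket 1 (n - 1) w2 (f (i - 1)) + bracket 1 (n - 1) w1 (f i),
             - bracket 1 (n - 2) w2 (g (i - 1)) - bracket 1 (n - 2) w1 (g i)
             - bracket (n - 1) 0 (f (i - 1)) D2 - bracket (n - 1) 0 (f i) D1)
          else if i = n + 1 then
            (bracket 1 (n - 1) w2 (f n),
             - bracket 1 (n - 2) w2 (g n) - bracket (n - 1) 0 (f n) D2)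
          else 0)))"

end

end

theory Submission
  imports Defs
begin

text \<open>
  For a single AssDer pair, \<open>[\<mu>, [\<mu>, f]] = 0\<close> and \<open>[\<mu>, [f, \<delta>]] = [[\<mu>, f], \<delta>]\<close>. Both are proved by
  recursion over the argument list: \<open>adj_sum \<mu> f\<close> is \<open>f \<circ> \<mu>\<close> and \<open>der_sum \<delta> f\<close> is \<open>f \<circ> \<delta>\<close>, and it
  suffices to see how these interact with each other and with the two outer terms of the Hochschild
  differential. The first identity is quadratic in \<open>\<mu>\<close>, the second bilinear in \<open>\<mu>\<close> and \<open>\<delta>\<close>, so
  applying them to \<open>(\<mu>1 + \<mu>2, \<delta>1 + \<delta>2)\<close>, which is an AssDer pair by compatibility, yields the mixed
  identities that make the entries of \<open>d (d c)\<close> cancel.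
\<close>

section \<open>Inserting a product or a derivation into a function of lists\<close>

fun adj_sum :: "('a \<Rightarrow> 'a \<Rightarrow> 'a) \<Rightarrow> ('a list \<Rightarrow> 'b::ab_group_add) \<Rightarrow> 'a list \<Rightarrow> 'b" where
  "adj_sum \<mu> f (x # y # xs) = f (\<mu> x y # xs) - adj_sum \<mu> (\<lambda>zs. f (x # zs)) (y # xs)"
| "adj_sum \<mu> f _ = 0"

fun der_sum :: "('a \<Rightarrow> 'a) \<Rightarrow> ('a list \<Rightarrow> 'b::ab_group_add) \<Rightarrow> 'a list \<Rightarrow> 'b" where
  "der_sum \<delta> f [] = 0"
| "der_sum \<delta> f (x # xs) = f (\<delta> x # xs) + der_sum \<delta> (\<lambda>zs. f (x # zs)) xs"

text \<open>Agreement at a single length is enough. The explicit formulas for brackets hold only at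
  the matching length, so this is what allows their substitution under the sum.\<close>

lemma adj_sum_cong:
  assumes "\<And>ys. length ys + 1 = length xs \<Longrightarrow> f ys = g ys"
  shows "adj_sum \<mu> f xs = adj_sum \<mu> g xs"
  using assms by (induction \<mu> f xs arbitrary: g rule: adj_sum.induct) auto

lemma der_sum_cong:
  assumes "\<And>ys. length ys = length xs \<Longrightarrow> f ys = g ys"
  shows "der_sum \<delta> f xs = der_sum \<delta> g xs"
  using assms by (induction \<delta> f xs arbitrary: g rule: der_sum.induct) auto

lemma adj_sum_add: "adj_sum \<mu> (\<lambda>ys. f ys + g ys) xs = adj_sum \<mu> f xs + adj_sum \<mu> g xs"
  by (induction \<mu> f xs arbitrary: g rule: adj_sum.induct) auto

lemma adj_sum_diff: "adj_sum \<mu> (\<lambda>ys. f ys - g ys) xs = adj_sum \<mu> f xs - adj_sum \<mu> g xs"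
  by (induction \<mu> f xs arbitrary: g rule: adj_sum.induct) auto

lemma der_sum_add: "der_sum \<delta> (\<lambda>ys. f ys + g ys) xs = der_sum \<delta> f xs + der_sum \<delta> g xs"
  by (induction \<delta> f xs arbitrary: g rule: der_sum.induct) auto

lemma der_sum_diff: "der_sum \<delta> (\<lambda>ys. f ys - g ys) xs = der_sum \<delta> f xs - der_sum \<delta> g xs"
  by (induction \<delta> f xs arbitrary: g rule: der_sum.induct) auto

lemma adj_sum_additive:
  assumes "additive h"
  shows "adj_sum \<mu> (\<lambda>ys. h (f ys)) xs = h (adj_sum \<mu> f xs)"
  by (induction \<mu> f xs rule: adj_sum.induct)
    (auto simp: additive.diff[OF assms] additive.zero[OF assms])

lemma der_sum_additive:
  assumes "additive h"
  shows "der_sum \<delta> (\<lambda>ys. h (f ys)) xs = h (der_sum \<delta> f xs)"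
  by (induction \<delta> f xs rule: der_sum.induct)
    (auto simp: additive.add[OF assms] additive.zero[OF assms])

lemma der_sum_snoc:
  "der_sum \<delta> f (xs @ [y]) = der_sum \<delta> (\<lambda>ys. f (ys @ [y])) xs + f (xs @ [\<delta> y])"
  by (induction xs arbitrary: f) (auto simp: algebra_simps)

text \<open>Splitting off the first argument \<open>x\<close> leaves the double sum of
  \<open>f (x # _)\<close>, which vanishes by induction, and the terms in which \<open>x\<close> is
  multiplied. These cancel in pairs once \<open>(x y) z\<close> and \<open>x (y z)\<close> are
  identified; disjoint products occur in both orders with opposite signs.\<close>

lemma adj_sum_adj_sum:
  assumes assoc: "\<And>x y z. \<mu> (\<mu> x y) z = \<mu> x (\<mu> y z)"
  shows "adj_sum \<mu> (adj_sum \<mu> f) xs = 0"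
proof (induction xs arbitrary: f rule: length_induct)
  case (1 xs)
  show ?case
  proof (cases "length xs \<ge> 3")
    case False
    then show ?thesis
      by (cases xs; cases "tl xs"; cases "tl (tl xs)"; auto)
  next
    case True
    then obtain x y z zs where xs: "xs = x # y # z # zs"
      by (auto simp: numeral_3_eq_3 Suc_le_length_iff)
    \<comment> \<open>The recursion equation needs two visible entries; \<open>hd\<close> and
      \<open>tl\<close> state it for a variable nonempty list \<open>l\<close>.\<close>
    have "adj_sum \<mu> (\<lambda>l. adj_sum \<mu> f (x # l)) (y # z # zs) =
      adj_sum \<mu> (\<lambda>l. f (\<mu> x (hd l) # tl l) - adj_sum \<mu> (\<lambda>l. f (x # l)) l) (y # z # zs)"
    proof (rule adj_sum_cong)
      fix ys :: "'a list"
      assume "length ys + 1 = length (y # z # zs)"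
      then show "adj_sum \<mu> f (x # ys) = f (\<mu> x (hd ys) # tl ys) - adj_sum \<mu> (\<lambda>l. f (x # l)) ys"
        by (cases ys) auto
    qed
    also have "\<dots> = adj_sum \<mu> (\<lambda>l. f (\<mu> x (hd l) # tl l)) (y # z # zs)"
      using 1[rule_format, of "y # z # zs"] xs by (simp add: adj_sum_diff del: adj_sum.simps)
    also have "\<dots> = f (\<mu> x (\<mu> y z) # zs) - adj_sum \<mu> (\<lambda>l. f (\<mu> x y # l)) (z # zs)"
      by (simp add: assoc)
    finally show ?thesis
      by (simp only: xs adj_sum.simps(1)[of \<mu> _ x y "z # zs"]
          adj_sum.simps(1)[of \<mu> _ "\<mu> x y" z zs] assoc diff_self)
  qed
qed

text \<open>Away from the product the two insertions commute. At the product, the Leibniz rule and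
  additivity of \<open>f\<close> in that slot split \<open>\<delta> (\<mu> x y)\<close> into the two
  terms in which \<delta> hits one of the factors first.\<close>

lemma adj_sum_der_sum:
  assumes Leibniz: "\<And>x y. \<delta> (\<mu> x y) = \<mu> (\<delta> x) y + \<mu> x (\<delta> y)"
    and f: "\<And>us vs x y. length us + length vs + 2 = length xs \<Longrightarrow>
      f (us @ (x + y) # vs) = f (us @ x # vs) + f (us @ y # vs)"
  shows "adj_sum \<mu> (der_sum \<delta> f) xs = der_sum \<delta> (adj_sum \<mu> f) xs"
  using f
proof (induction xs arbitrary: f)
  case Nil
  then show ?case by simp
next
  case (Cons x xs)
  show ?case
  proof (cases xs)
    case Nil
    then show ?thesis by simp
  next
    case [simp]: (Cons y ys)
    have f0: "f ((a + b) # ys) = f (a # ys) + f (b # ys)" for a b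
      using Cons.prems[of "[]" ys a b] by simp
    have IH: "adj_sum \<mu> (der_sum \<delta> (\<lambda>l. f (x # l))) (y # ys) =
        der_sum \<delta> (adj_sum \<mu> (\<lambda>l. f (x # l))) (y # ys)"
      using Cons.IH[of "\<lambda>l. f (x # l)"] Cons.prems[of "x # _"] by simp
    have "der_sum \<delta> (\<lambda>l. adj_sum \<mu> f (x # l)) (y # ys) =
      der_sum \<delta> (\<lambda>l. f (\<mu> x (hd l) # tl l) - adj_sum \<mu> (\<lambda>l. f (x # l)) l) (y # ys)"
    proof (rule der_sum_cong)
      fix zs :: "'a list"
      assume "length zs = length (y # ys)"
      then show "adj_sum \<mu> f (x # zs) = f (\<mu> x (hd zs) # tl zs) - adj_sum \<mu> (\<lambda>l. f (x # l)) zs"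
        by (cases zs) auto
    qed
    also have "\<dots> = f (\<mu> x (\<delta> y) # ys) + der_sum \<delta> (\<lambda>l. f (\<mu> x y # l)) ys
        - adj_sum \<mu> (der_sum \<delta> (\<lambda>l. f (x # l))) (y # ys)"
      by (simp only: der_sum_diff IH) simp
    finally have "der_sum \<delta> (adj_sum \<mu> f) (x # y # ys) =
        f (\<mu> (\<delta> x) y # ys) - adj_sum \<mu> (\<lambda>l. f (\<delta> x # l)) (y # ys) +
        (f (\<mu> x (\<delta> y) # ys) + der_sum \<delta> (\<lambda>l. f (\<mu> x y # l)) ys
          - adj_sum \<mu> (der_sum \<delta> (\<lambda>l. f (x # l))) (y # ys))"
      by (simp only: der_sum.simps(2)[of \<delta> _ x "y # ys"] adj_sum.simps(1)[of \<mu> f "\<delta> x" y ys])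
    moreover have "adj_sum \<mu> (der_sum \<delta> f) (x # y # ys) =
        f (\<mu> (\<delta> x) y # ys) + f (\<mu> x (\<delta> y) # ys) + der_sum \<delta> (\<lambda>l. f (\<mu> x y # l)) ys -
        (adj_sum \<mu> (\<lambda>l. f (\<delta> x # l)) (y # ys) + adj_sum \<mu> (der_sum \<delta> (\<lambda>l. f (x # l))) (y # ys))"
      by (simp only: adj_sum.simps(1)[of \<mu> _ x y ys] der_sum.simps(2) adj_sum_add Leibniz f0)
    ultimately show ?thesis
      by (simp only: Cons) simp
  qed
qed

section \<open>Brackets as recursive sums\<close>

context char0_vector_space
begin

lemma linear_iff_scale:
  "Vector_Spaces.linear scale scale h \<longleftrightarrow>
    (\<forall>x y. h (x + y) = h x + h y) \<and> (\<forall>r x. h (scale r x) = scale r (h x))"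
  using vector_space_axioms by (simp add: Vector_Spaces.linear_iff)

text \<open>The recursion peels arguments from the left; the outer term in which the last argument
  multiplies a value of \<open>f\<close> needs the last pair split off instead. That pair is at
  position \<open>length xs\<close>, which gives its sign.\<close>

lemma adj_sum_snoc:
  "adj_sum \<mu> f (xs @ [y, z]) =
    adj_sum \<mu> (\<lambda>ys. f (ys @ [z])) (xs @ [y]) + scale ((-1) ^ length xs) (f (xs @ [\<mu> y z]))"
proof (induction xs arbitrary: f)
  case (Cons x xs)
  show ?case
    using Cons.IH[of "\<lambda>zs. f (x # zs)"] by (cases xs) (auto simp: algebra_simps)
qed simp

lemma adj_sum_eq_sum:
  "adj_sum \<mu> f xs = (\<Sum>k<length xs - 1. scale ((-1) ^ k)
    (f (take k xs @ [\<mu> (xs ! k) (xs ! Suc k)] @ drop (k + 2) xs)))"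
proof (induction \<mu> f xs rule: adj_sum.induct)
  case (1 \<mu> f x y xs)
  show ?case
    by (simp add: 1 sum.lessThan_Suc_shift sum_negf del: sum.lessThan_Suc)
qed simp_all

lemma der_sum_eq_sum:
  "der_sum \<delta> f xs = (\<Sum>k<length xs. f (take k xs @ [\<delta> (xs ! k)] @ drop (k + 1) xs))"
proof (induction xs arbitrary: f)
  case (Cons x xs)
  show ?case
    by (simp add: Cons sum.lessThan_Suc_shift del: sum.lessThan_Suc)
qed simp

text \<open>Shifting the index to start at 0 removes the truncated subtraction and matches the
  indexed forms of \<open>adj_sum\<close> and \<open>der_sum\<close>.\<close>

lemma circ_eq_sum:
  assumes "length xs = p + q + 1"
  shows "circ p q f g xs = (\<Sum>k<p + 1. scale ((-1) ^ (k * q))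
    (f (take k xs @ [g (take (q + 1) (drop k xs))] @ drop (k + q + 1) xs)))"
proof -
  have "{1..p + 1} = Suc ` {..<p + 1}"
    by (simp add: image_Suc_lessThan)
  then show ?thesis
    using assms by (simp add: circ_def sum.reindex del: sum.lessThan_Suc)
qed

text \<open>Up to the factor \<open>(-1) ^ m\<close> this is the Hochschild coboundary of
  \<open>f\<close>. The arguments are displayed as \<open>x # us @ [z]\<close> because
  \<open>x\<close> and \<open>z\<close> are the factors that can stand outside
  \<open>f\<close>.\<close>

lemma bracket_cochain2:
  assumes "length us = m" and \<mu>0: "\<And>x. \<mu> x 0 = 0"
  shows "bracket 1 m (cochain2 \<mu>) f (x # us @ [z]) =
    scale ((-1) ^ m) (\<mu> x (f (us @ [z])) - adj_sum \<mu> f (x # us @ [z])) + \<mu> (f (x # us)) z"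
proof -
  let ?xs = "x # us @ [z]"
  have "circ 1 m (cochain2 \<mu>) f ?xs = \<mu> (f (x # us)) z + scale ((-1) ^ m) (\<mu> x (f (us @ [z])))"
    using assms(1) by (simp add: circ_eq_sum cochain2_def)
  moreover have "circ m 1 f (cochain2 \<mu>) ?xs = adj_sum \<mu> f ?xs"
  proof -
    have "take 2 (drop k ?xs) = [?xs ! k, ?xs ! Suc k]" if "k < m + 1" for k
      using that assms(1) by (simp add: Cons_nth_drop_Suc[symmetric] numeral_2_eq_2 del: drop_Suc_Cons)
    then show ?thesis
      using assms(1) unfolding adj_sum_eq_sum
      by (subst circ_eq_sum) (auto simp: cochain2_def numeral_2_eq_2 intro!: sum.cong)
  qed
  ultimately show ?thesis
    by (simp add: bracket_def cscale_def algebra_simps)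
qed

text \<open>Since \<delta> has degree 0, all signs are 1 and the bracket is a plain
  commutator.\<close>

lemma bracket_cochain1:
  assumes "length xs = m + 1"
  shows "bracket m 0 f (cochain1 \<delta>) xs = der_sum \<delta> f xs - \<delta> (f xs)"
proof -
  have "circ 0 m (cochain1 \<delta>) f xs = \<delta> (f xs)"
    using assms by (simp add: circ_eq_sum cochain1_def)
  moreover have "circ m 0 f (cochain1 \<delta>) xs = der_sum \<delta> f xs"
  proof -
    have "take (Suc 0) (drop k xs) = [xs ! k]" if "k < m + 1" for k
      using that assms by (simp add: Cons_nth_drop_Suc[symmetric])
    then show ?thesis
      using assms unfolding der_sum_eq_sum
      by (subst circ_eq_sum) (auto simp: cochain1_def intro!: sum.cong)
  qed
  ultimately show ?thesis
    by (simp add: bracket_def cscale_def)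
qed

lemma bracket_length: "length xs \<noteq> p + q + 1 \<Longrightarrow> bracket p q f g xs = 0"
  by (simp add: bracket_def cscale_def circ_def algebra_simps)


section \<open>Multilinearity of insertions and brackets\<close>

lemma cochains_iff:
  "f \<in> cochains n \<longleftrightarrow> (\<forall>xs. length xs \<noteq> n \<longrightarrow> f xs = 0) \<and>
    (\<forall>us vs. length us + 1 + length vs = n \<longrightarrow>
      (\<forall>x y. f (us @ (x + y) # vs) = f (us @ x # vs) + f (us @ y # vs)) \<and>
      (\<forall>r x. f (us @ scale r x # vs) = scale r (f (us @ x # vs))))"
  by (simp add: cochains_def linear_iff_scale)

lemma cochains_add_arg:
  "f \<in> cochains n \<Longrightarrow> length us + length vs + 1 = n \<Longrightarrow>
    f (us @ (x + y) # vs) = f (us @ x # vs) + f (us @ y # vs)"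
  by (simp add: cochains_iff)

lemma cochains_scale_arg:
  "f \<in> cochains n \<Longrightarrow> length us + length vs + 1 = n \<Longrightarrow>
    f (us @ scale r x # vs) = scale r (f (us @ x # vs))"
  by (simp add: cochains_iff)

lemma cochains_zero [simp]: "0 \<in> cochains n"
  by (simp add: cochains_iff)

lemma cochains_add: "f \<in> cochains n \<Longrightarrow> g \<in> cochains n \<Longrightarrow> f + g \<in> cochains n"
  by (simp add: cochains_iff scale_right_distrib)

lemma cochains_cscale: "f \<in> cochains n \<Longrightarrow> cscale r f \<in> cochains n"
  by (simp add: cochains_iff cscale_def scale_right_distrib mult.commute)

lemma cochains_diff: "f \<in> cochains n \<Longrightarrow> g \<in> cochains n \<Longrightarrow> f - g \<in> cochains n"
  by (simp add: cochains_iff scale_right_diff_distrib)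

lemma cscale_add: "cscale r (f + g) = cscale r f + cscale r g"
  by (auto simp: cscale_def scale_right_distrib)

lemma cscale_diff: "cscale r (f - g) = cscale r f - cscale r g"
  by (auto simp: cscale_def scale_right_diff_distrib)

lemma cscale_uminus: "cscale r (- f) = - cscale r f"
  by (auto simp: cscale_def)

lemma cscale_minus: "cscale (- r) f = - cscale r f"
  by (auto simp: cscale_def)

lemma cscale_zero [simp]: "cscale r 0 = 0"
  by (auto simp: cscale_def)

lemma cscale_0 [simp]: "cscale 0 f = 0"
  by (auto simp: cscale_def)

lemma cscale_1 [simp]: "cscale 1 f = f"
  by (auto simp: cscale_def)

lemma cscale_commute: "cscale r (cscale s f) = cscale s (cscale r f)"
  by (auto simp: cscale_def mult.commute)

text \<open>Here \<open>h\<close> is a summand of \<open>circ\<close> without its sign. The slot of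
  \<open>x\<close> lies before, inside or after the block of \<open>q + 1\<close> arguments given to
  \<open>g\<close>. Outside the block it is a slot of \<open>f\<close> with the value of
  \<open>g\<close> held fixed; inside, a slot of \<open>g\<close> is composed with a slot of
  \<open>f\<close>.\<close>

lemma insertion_linear:
  assumes f: "f \<in> cochains (p + 1)" and g: "g \<in> cochains (q + 1)"
    and k: "k < p + 1" and len: "length us + 1 + length vs = p + q + 1"
  defines "h \<equiv> \<lambda>xs. f (take k xs @ [g (take (q + 1) (drop k xs))] @ drop (k + q + 1) xs)"
  shows "Vector_Spaces.linear scale scale (\<lambda>x. h (us @ [x] @ vs))"
proof -
  consider "length us < k" | "k \<le> length us" "length us \<le> k + q" | "k + q < length us"
    by linarith
  then show ?thesis
  proof cases
    case 1
    then obtain j where j: "k = Suc (length us + j)"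
      using less_iff_Suc_add by auto
    have "h (us @ [x] @ vs) =
        f (us @ [x] @ take j vs @ [g (take (q + 1) (drop j vs))] @ drop (j + q + 1) vs)" for x
      by (simp add: h_def j)
    then show ?thesis
      using f len k j unfolding cochains_def by auto
  next
    case 2
    then obtain j i where ji: "length us = k + j" "q = j + i"
      using le_Suc_ex by (metis add_le_cancel_left)
    have h: "h (us @ [x] @ vs) =
        f (take k us @ [g (drop k us @ [x] @ take i vs)] @ drop i vs)" for x
      using ji by (simp add: h_def)
    have "g (drop k us @ (x + y) # take i vs) =
        g (drop k us @ x # take i vs) + g (drop k us @ y # take i vs)"
      and "g (drop k us @ scale r x # take i vs) = scale r (g (drop k us @ x # take i vs))" for x y r
      using cochains_add_arg[OF g, of "drop k us" "take i vs"]
        cochains_scale_arg[OF g, of "drop k us" "take i vs"] ji len k by auto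
    moreover have "f (take k us @ (x + y) # drop i vs) =
        f (take k us @ x # drop i vs) + f (take k us @ y # drop i vs)"
      and "f (take k us @ scale r x # drop i vs) = scale r (f (take k us @ x # drop i vs))" for x y r
      using cochains_add_arg[OF f, of "take k us" "drop i vs"]
        cochains_scale_arg[OF f, of "take k us" "drop i vs"] ji len k by auto
    ultimately show ?thesis
      unfolding linear_iff_scale h by simp
  next
    case 3
    then obtain j where j: "length us = Suc (k + q + j)"
      using less_iff_Suc_add by auto
    define ws where "ws = take k us @ [g (take (q + 1) (drop k us))] @ drop (k + q + 1) us"
    have "h (us @ [x] @ vs) = f (ws @ [x] @ vs)" for x
      using j by (simp add: h_def ws_def)
    moreover have "length ws + 1 + length vs = p + 1"
      using len k j by (simp add: ws_def)
    ultimately show ?thesis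
      using f by (simp add: cochains_def)
  qed
qed

lemma circ_cochains:
  assumes "f \<in> cochains (p + 1)" "g \<in> cochains (q + 1)"
  shows "circ p q f g \<in> cochains (p + q + 1)"
proof -
  have "circ p q f g xs = 0" if "length xs \<noteq> p + q + 1" for xs
    using that by (simp add: circ_def)
  moreover have "Vector_Spaces.linear scale scale (\<lambda>x. circ p q f g (us @ [x] @ vs))"
    if len: "length us + 1 + length vs = p + q + 1" for us vs
  proof -
    have *: "length (us @ [x] @ vs) = p + q + 1" for x
      using len by simp
    show ?thesis
      unfolding circ_eq_sum[OF *] linear_iff_scale
      using insertion_linear[OF assms _ len, unfolded linear_iff_scale]
      by (auto simp del: append.simps append_Cons append_assoc sum.lessThan_Suc
          simp: scale_right_distrib sum.distrib scale_sum_right scale_left_commute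
          intro!: sum.cong)
  qed
  ultimately show ?thesis
    by (simp add: cochains_def)
qed

lemma bracket_cochains:
  assumes "f \<in> cochains (p + 1)" "g \<in> cochains (q + 1)"
  shows "bracket p q f g \<in> cochains (p + q + 1)"
  using circ_cochains[OF assms] circ_cochains[OF assms(2,1)]
  by (auto simp: bracket_def add.commute intro!: cochains_diff cochains_cscale)

section \<open>Bilinearity of the bracket\<close>

lemma circ_add_left: "circ p q (f + f') g = circ p q f g + circ p q f' g"
  by (auto simp: circ_def scale_right_distrib sum.distrib simp del: sum.cl_ivl_Suc)

lemma circ_cscale_left: "circ p q (cscale r f) g = cscale r (circ p q f g)"
  by (auto simp: circ_def cscale_def scale_sum_right mult.commute simp del: sum.cl_ivl_Suc)

text \<open>The right operand is evaluated inside an argument of \<open>f\<close>, so multilinearity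
  of \<open>f\<close> enters, whereas the left operand is handled pointwise. As a bracket contains
  both orders, linearity in one operand asks the other to be a cochain.\<close>

lemma circ_add_right:
  assumes "f \<in> cochains (p + 1)"
  shows "circ p q f (g + g') = circ p q f g + circ p q f g'"
proof
  fix xs
  show "circ p q f (g + g') xs = (circ p q f g + circ p q f g') xs"
  proof (cases "length xs = p + q + 1")
    case True
    then show ?thesis
      by (simp add: circ_eq_sum cochains_add_arg[OF assms] scale_right_distrib sum.distrib
          flip: sum.distrib del: sum.lessThan_Suc)
  qed (simp add: circ_def)
qed

lemma circ_cscale_right:
  assumes "f \<in> cochains (p + 1)"
  shows "circ p q f (cscale r g) = cscale r (circ p q f g)"
proof
  fix xs
  show "circ p q f (cscale r g) xs = cscale r (circ p q f g) xs"
  proof (cases "length xs = p + q + 1")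
    case True
    then show ?thesis
      by (simp add: circ_eq_sum cscale_def cochains_scale_arg[OF assms] scale_sum_right mult.commute
          del: sum.lessThan_Suc)
  qed (simp add: circ_def cscale_def)
qed

lemma bracket_add_left:
  "g \<in> cochains (q + 1) \<Longrightarrow> bracket p q (f + f') g = bracket p q f g + bracket p q f' g"
  by (simp add: bracket_def circ_add_left circ_add_right cscale_add)

lemma bracket_add_right:
  "f \<in> cochains (p + 1) \<Longrightarrow> bracket p q f (g + g') = bracket p q f g + bracket p q f g'"
  by (simp add: bracket_def circ_add_left circ_add_right cscale_add)

lemma bracket_cscale_left:
  "g \<in> cochains (q + 1) \<Longrightarrow> bracket p q (cscale r f) g = cscale r (bracket p q f g)"
  by (simp add: bracket_def circ_cscale_left circ_cscale_right cscale_diff cscale_commute)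

lemma bracket_cscale_right:
  "f \<in> cochains (p + 1) \<Longrightarrow> bracket p q f (cscale r g) = cscale r (bracket p q f g)"
  by (simp add: bracket_def circ_cscale_left circ_cscale_right cscale_diff cscale_commute)

lemma bracket_zero_left: "g \<in> cochains (q + 1) \<Longrightarrow> bracket p q 0 g = 0"
  using bracket_cscale_left[of g q p 0 0] by simp

lemma bracket_zero_right: "f \<in> cochains (p + 1) \<Longrightarrow> bracket p q f 0 = 0"
  using bracket_cscale_right[of f p q 0 0] by simp

lemma cochain2_add: "cochain2 (\<lambda>x y. \<mu> x y + \<nu> x y) = (cochain2 \<mu> + cochain2 \<nu> :: 'a cochain)"
  by (auto simp: cochain2_def split: list.split)

lemma cochain1_add: "cochain1 (\<lambda>x. \<delta> x + \<epsilon> x) = (cochain1 \<delta> + cochain1 \<epsilon> :: 'a cochain)"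
  by (auto simp: cochain1_def split: list.split)

end

section \<open>The two bracket identities of a single AssDer pair\<close>

context AssDer_pair
begin

lemma additive_mult_left: "additive (\<lambda>x. \<mu> x y)"
  using linear_mult_left by (simp add: additive_def linear_iff_scale)

lemma additive_mult_right: "additive (\<mu> x)"
  using linear_mult_right by (simp add: additive_def linear_iff_scale)

lemma additive_der: "additive \<delta>"
  using linear_der by (simp add: additive_def linear_iff_scale)

lemma additive_scale: "additive (scale r)"
  by (simp add: additive_def scale_right_distrib)

lemmas mult_additive =
  additive.add[OF additive_mult_left] additive.add[OF additive_mult_right]
  additive.diff[OF additive_mult_left] additive.diff[OF additive_mult_right]
  additive.minus[OF additive_mult_left] additive.minus[OF additive_mult_right]
  additive.zero[OF additive_mult_right]

text \<open>The arity is kept as \<open>1 + 1\<close> to match the pattern \<open>p + 1\<close> of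
  the bracket lemmas.\<close>

lemma mult_cochain: "cochain2 \<mu> \<in> cochains (1 + 1)"
proof -
  have "us = [] \<and> (\<exists>y. vs = [y]) \<or> (\<exists>y. us = [y]) \<and> vs = []"
    if "length us + 1 + length vs = 1 + 1" for us vs :: "'a list"
    using that by (cases us; cases vs) auto
  then show ?thesis
    using linear_mult_left linear_mult_right
    by (fastforce simp: cochains_iff cochain2_def linear_iff_scale split: list.split)
qed

lemma der_cochain: "cochain1 \<delta> \<in> cochains (0 + 1)"
  using linear_der
  by (auto simp: cochains_iff cochain1_def linear_iff_scale split: list.split)

lemma bracket_mult:
  "length us = m \<Longrightarrow> bracket 1 m (cochain2 \<mu>) f (x # us @ [z]) =
    scale ((-1) ^ m) (\<mu> x (f (us @ [z])) - adj_sum \<mu> f (x # us @ [z])) + \<mu> (f (x # us)) z"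
  by (rule bracket_cochain2) (auto simp: mult_additive)

text \<open>With the outer arguments read off by \<open>hd\<close>, \<open>tl\<close>,
  \<open>butlast\<close> and \<open>last\<close>, the formula becomes a function of the whole list
  and can be substituted under \<open>adj_sum\<close> and \<open>der_sum\<close>.\<close>

lemma bracket_mult_hd_tl:
  assumes "length xs = m + 2"
  shows "bracket 1 m (cochain2 \<mu>) f xs =
    scale ((-1) ^ m) (\<mu> (hd xs) (f (tl xs)) - adj_sum \<mu> f xs) + \<mu> (f (butlast xs)) (last xs)"
proof -
  obtain x ys where ys: "xs = x # ys" "length ys = Suc m"
    using assms by (auto simp: length_Suc_conv)
  then obtain us z where us: "ys = us @ [z]" "length us = m"
    by (auto simp: length_Suc_conv_rev)
  show ?thesis
    using bracket_mult[OF us(2), of f x z] ys us by (simp add: butlast_append)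
qed

text \<open>This is the square of the Hochschild differential. Conceptually it follows from the
  graded Jacobi identity and \<open>[\<mu>, \<mu>] = 0\<close>; here inner products are separated
  from outer ones and the terms are matched directly.\<close>

lemma bracket_mult_mult: "bracket 1 (m + 1) (cochain2 \<mu>) (bracket 1 m (cochain2 \<mu>) f) = 0"
proof
  fix xs
  let ?d = "bracket 1 m (cochain2 \<mu>) f"
  let ?s = "(-1) ^ m :: 'k"
  show "bracket 1 (m + 1) (cochain2 \<mu>) ?d xs = 0 xs"
  proof (cases "length xs = m + 3")
    case False
    then show ?thesis
      by (simp add: bracket_length)
  next
    case True
    then obtain x ys where ys: "xs = x # ys" "length ys = Suc (Suc m)"
      by (auto simp: length_Suc_conv numeral_3_eq_3)
    then obtain us y z where us: "ys = us @ [y, z]" "length us = m"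
      by (auto simp: length_Suc_conv_rev)
    have xs: "xs = x # us @ [y, z]"
      using ys us by simp
    \<comment> \<open>The second argument \<open>a\<close> and the last but one \<open>y\<close>
      coincide when \<open>m = 0\<close>, so the same list is split in two ways instead of being
      written with both ends visible.\<close>
    obtain a vs where a: "us @ [y] = a # vs" "length vs = m"
      using us by (metis length_Suc_conv length_append_singleton)
    have a': "us @ [y, z] = a # vs @ [z]"
      using a by (metis append.assoc append_Cons append_Nil)
    have "adj_sum \<mu> ?d xs = adj_sum \<mu> (\<lambda>l. scale ?s (\<mu> (hd l) (f (tl l)) - adj_sum \<mu> f l)
        + \<mu> (f (butlast l)) (last l)) xs"
      by (rule adj_sum_cong, rule bracket_mult_hd_tl) (use True in simp)
    also have "\<dots> = scale ?s (adj_sum \<mu> (\<lambda>l. \<mu> (hd l) (f (tl l))) xs)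
        + adj_sum \<mu> (\<lambda>l. \<mu> (f (butlast l)) (last l)) xs"
      by (simp only: adj_sum_add adj_sum_additive[OF additive_scale] adj_sum_diff
          adj_sum_adj_sum[of \<mu>, OF assoc] diff_zero)
    \<comment> \<open>Either the inner product absorbs the outer factor \<open>x\<close>, giving
      \<open>\<mu> x a\<close>, or it lies to the right of \<open>x\<close>, which is then pulled
      out by additivity.\<close>
    also have "adj_sum \<mu> (\<lambda>l. \<mu> (hd l) (f (tl l))) xs =
        \<mu> (\<mu> x a) (f (vs @ [z])) - \<mu> x (adj_sum \<mu> f (a # vs @ [z]))"
      unfolding xs a' by (simp add: adj_sum_additive[OF additive_mult_right])
    \<comment> \<open>The mirror image: the last product is at position \<open>m + 1\<close>, hence
      the sign \<open>- ?s\<close>.\<close>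
    also have "adj_sum \<mu> (\<lambda>l. \<mu> (f (butlast l)) (last l)) xs =
        \<mu> (adj_sum \<mu> f (x # us @ [y])) z - scale ?s (\<mu> (f (x # us)) (\<mu> y z))"
      using adj_sum_snoc[of \<mu> "\<lambda>l. \<mu> (f (butlast l)) (last l)" "x # us" y z] us(2)
      by (simp add: xs butlast_append adj_sum_additive[OF additive_mult_left])
    finally have S: "adj_sum \<mu> ?d xs =
        scale ?s (\<mu> (\<mu> x a) (f (vs @ [z])) - \<mu> x (adj_sum \<mu> f (a # vs @ [z])))
        + (\<mu> (adj_sum \<mu> f (x # us @ [y])) z - scale ?s (\<mu> (f (x # us)) (\<mu> y z)))" .
    have "bracket 1 (m + 1) (cochain2 \<mu>) ?d xs =
        scale (- ?s) (\<mu> x (?d (a # vs @ [z])) - adj_sum \<mu> ?d xs) + \<mu> (?d (x # us @ [y])) z"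
      using bracket_mult[of "us @ [y]" "m + 1" ?d x z] us(2) by (simp add: xs a')
    \<comment> \<open>Associativity pairs off the terms with two outer products: both on the left,
      both on the right, or one on each side. Terms with one inner product cancel directly. The
      parity of \<open>m\<close> turns the signs into explicit ones.\<close>
    then show ?thesis
      unfolding S bracket_mult[OF us(2)] bracket_mult[OF a(2)]
      by (cases "even m") (simp_all add: mult_additive assoc flip: a(1))
  qed
qed

text \<open>Conceptually, this is the graded Jacobi identity for \<mu>, \<open>f\<close> and
  \<delta>, with \<open>[\<mu>, \<delta>] = 0\<close> by the Leibniz rule.\<close>

lemma bracket_mult_der:
  assumes f: "f \<in> cochains (m + 1)"
  shows "bracket 1 m (cochain2 \<mu>) (bracket m 0 f (cochain1 \<delta>)) =
    bracket (m + 1) 0 (bracket 1 m (cochain2 \<mu>) f) (cochain1 \<delta>)" (is "?L = ?R")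
proof
  fix xs
  let ?d = "bracket 1 m (cochain2 \<mu>) f"
  let ?k = "bracket m 0 f (cochain1 \<delta>)"
  let ?s = "(-1) ^ m :: 'k"
  show "?L xs = ?R xs"
  proof (cases "length xs = m + 2")
    case False
    then show ?thesis
      by (simp add: bracket_length)
  next
    case True
    then obtain x ys where ys: "xs = x # ys" "length ys = Suc m"
      by (auto simp: length_Suc_conv)
    then obtain us z where us: "ys = us @ [z]" "length us = m"
      by (auto simp: length_Suc_conv_rev)
    have xs: "xs = x # us @ [z]"
      using ys us by simp
    have ES: "adj_sum \<mu> (der_sum \<delta> f) xs = der_sum \<delta> (adj_sum \<mu> f) xs"
      using True by (intro adj_sum_der_sum Leibniz cochains_add_arg[OF f]) auto
    have "adj_sum \<mu> ?k xs = adj_sum \<mu> (\<lambda>l. der_sum \<delta> f l - \<delta> (f l)) xs"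
      by (rule adj_sum_cong, rule bracket_cochain1) (use True in simp)
    then have S: "adj_sum \<mu> ?k xs = der_sum \<delta> (adj_sum \<mu> f) xs - \<delta> (adj_sum \<mu> f xs)"
      by (simp only: adj_sum_diff adj_sum_additive[OF additive_der] ES)
    have "der_sum \<delta> ?d xs = der_sum \<delta> (\<lambda>l. scale ?s (\<mu> (hd l) (f (tl l)) - adj_sum \<mu> f l)
        + \<mu> (f (butlast l)) (last l)) xs"
      by (rule der_sum_cong, rule bracket_mult_hd_tl) (use True in simp)
    also have "\<dots> = scale ?s (der_sum \<delta> (\<lambda>l. \<mu> (hd l) (f (tl l))) xs - der_sum \<delta> (adj_sum \<mu> f) xs)
        + der_sum \<delta> (\<lambda>l. \<mu> (f (butlast l)) (last l)) xs"
      by (simp only: der_sum_add der_sum_additive[OF additive_scale] der_sum_diff)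
    also have "der_sum \<delta> (\<lambda>l. \<mu> (hd l) (f (tl l))) xs =
        \<mu> (\<delta> x) (f (us @ [z])) + \<mu> x (der_sum \<delta> f (us @ [z]))"
      by (simp add: xs der_sum_additive[OF additive_mult_right])
    also have "der_sum \<delta> (\<lambda>l. \<mu> (f (butlast l)) (last l)) xs =
        \<mu> (der_sum \<delta> f (x # us)) z + \<mu> (f (x # us)) (\<delta> z)"
      using der_sum_snoc[of \<delta> "\<lambda>l. \<mu> (f (butlast l)) (last l)" "x # us" z]
      by (simp add: xs butlast_append der_sum_additive[OF additive_mult_left] mult_additive
          del: der_sum.simps)
    finally have E: "der_sum \<delta> ?d xs = scale ?s (\<mu> (\<delta> x) (f (us @ [z]))
        + \<mu> x (der_sum \<delta> f (us @ [z])) - der_sum \<delta> (adj_sum \<mu> f) xs)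
        + (\<mu> (der_sum \<delta> f (x # us)) z + \<mu> (f (x # us)) (\<delta> z))" .
    have "?L xs = scale ?s (\<mu> x (?k (us @ [z])) - adj_sum \<mu> ?k xs) + \<mu> (?k (x # us)) z"
      using bracket_mult[OF us(2)] by (simp add: xs)
    also have "\<dots> = scale ?s (\<mu> x (der_sum \<delta> f (us @ [z]) - \<delta> (f (us @ [z]))) - adj_sum \<mu> ?k xs)
        + \<mu> (der_sum \<delta> f (x # us) - \<delta> (f (x # us))) z"
      using us by (simp add: bracket_cochain1 del: der_sum.simps)
    \<comment> \<open>In this difference the terms with \<open>\<delta> x\<close> or
      \<open>\<delta> z\<close> as outer factor cancel against those from the Leibniz rule for
      \<delta> applied to the outer products.\<close>
    also have "\<dots> = der_sum \<delta> ?d xs - \<delta> (scale ?s (\<mu> x (f (us @ [z])) - adj_sum \<mu> f xs) + \<mu> (f (x # us)) z)"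
      unfolding S E
      by (cases "even m") (simp_all add: mult_additive Leibniz additive.add[OF additive_der]
          additive.diff[OF additive_der] additive.minus[OF additive_der] del: der_sum.simps adj_sum.simps)
    also have "\<dots> = ?R xs"
      using True bracket_mult[OF us(2), of f x z] by (simp add: bracket_cochain1 xs)
    finally show ?thesis .
  qed
qed

end


section \<open>Mixed identities from compatibility\<close>

context compatible_AssDer_pair
begin

text \<open>After expansion the pure terms agree by the axioms of each pair, and the mixed terms are
  exactly the two compatibility equations.\<close>

lemma sum_AssDer_pair: "AssDer_pair scale (\<lambda>x y. \<mu>1 x y + \<mu>2 x y) (\<lambda>x. \<delta>1 x + \<delta>2 x)"
proof unfold_locales
  fix x y z
  show "\<mu>1 (\<mu>1 x y + \<mu>2 x y) z + \<mu>2 (\<mu>1 x y + \<mu>2 x y) z =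
      \<mu>1 x (\<mu>1 y z + \<mu>2 y z) + \<mu>2 x (\<mu>1 y z + \<mu>2 y z)"
    using compatible_mult[of x y z]
    by (simp add: P1.mult_additive P2.mult_additive P1.assoc P2.assoc algebra_simps)
  show "\<delta>1 (\<mu>1 x y + \<mu>2 x y) + \<delta>2 (\<mu>1 x y + \<mu>2 x y) =
      \<mu>1 (\<delta>1 x + \<delta>2 x) y + \<mu>2 (\<delta>1 x + \<delta>2 x) y + (\<mu>1 x (\<delta>1 y + \<delta>2 y) + \<mu>2 x (\<delta>1 y + \<delta>2 y))"
    using compatible_der[of x y]
    by (simp add: P1.mult_additive P2.mult_additive P1.Leibniz P2.Leibniz
        additive.add[OF P1.additive_der] additive.add[OF P2.additive_der] algebra_simps)
qed (use P1.linear_mult_left P1.linear_mult_right P1.linear_der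
      P2.linear_mult_left P2.linear_mult_right P2.linear_der in
    \<open>simp_all add: linear_iff_scale scale_right_distrib\<close>)

lemma bracket_w_cochains:
  assumes "f \<in> cochains (m + 1)"
  shows "bracket 1 m w1 f \<in> cochains (m + 2)" "bracket 1 m w2 f \<in> cochains (m + 2)"
  using bracket_cochains[OF P1.mult_cochain assms] bracket_cochains[OF P2.mult_cochain assms] by simp_all

lemma bracket_D_cochains:
  assumes "f \<in> cochains (m + 1)"
  shows "bracket m 0 f D1 \<in> cochains (m + 1)" "bracket m 0 f D2 \<in> cochains (m + 1)"
  using bracket_cochains[OF assms P1.der_cochain] bracket_cochains[OF assms P2.der_cochain] by simp_all

text \<open>The \<open>simplified\<close> copies have the index \<open>1\<close> in the form
  \<open>Suc 0\<close>, to which simplification turns it in goals.\<close>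

lemmas bracket_w_add =
  bracket_add_right[OF P1.mult_cochain] bracket_add_right[OF P2.mult_cochain]
  bracket_add_right[OF P1.mult_cochain, simplified] bracket_add_right[OF P2.mult_cochain, simplified]

lemmas bracket_w_cscale =
  bracket_cscale_right[OF P1.mult_cochain] bracket_cscale_right[OF P2.mult_cochain]
  bracket_cscale_right[OF P1.mult_cochain, simplified] bracket_cscale_right[OF P2.mult_cochain, simplified]

lemmas bracket_D_add =
  bracket_add_left[OF P1.der_cochain] bracket_add_left[OF P2.der_cochain]

lemmas bracket_D_cscale =
  bracket_cscale_left[OF P1.der_cochain] bracket_cscale_left[OF P2.der_cochain]

lemmas bracket_w_zero =
  bracket_zero_right[OF P1.mult_cochain] bracket_zero_right[OF P2.mult_cochain]
  bracket_zero_right[OF P1.mult_cochain, simplified] bracket_zero_right[OF P2.mult_cochain, simplified]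

lemmas bracket_D_zero =
  bracket_zero_left[OF P1.der_cochain] bracket_zero_left[OF P2.der_cochain]

text \<open>Polarization: in the square of the bracket with \<open>w1 + w2\<close> both pure squares
  vanish, so the mixed ones add up to 0. The equation is oriented as a rewrite rule that moves
  \<open>w2\<close> inside.\<close>

lemma bracket_w_w:
  assumes f: "f \<in> cochains (m + 1)"
  shows "bracket 1 (m + 1) w2 (bracket 1 m w1 f) = - bracket 1 (m + 1) w1 (bracket 1 m w2 f)"
proof -
  interpret S: AssDer_pair scale "\<lambda>x y. \<mu>1 x y + \<mu>2 x y" "\<lambda>x. \<delta>1 x + \<delta>2 x"
    by (rule sum_AssDer_pair)
  have "bracket 1 m w1 f \<in> cochains ((m + 1) + 1)" "bracket 1 m w2 f \<in> cochains ((m + 1) + 1)"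
    using bracket_w_cochains[OF f] by simp_all
  then have "bracket 1 (m + 1) w2 (bracket 1 m w1 f) + bracket 1 (m + 1) w1 (bracket 1 m w2 f) = 0"
    using S.bracket_mult_mult[of m f] P1.bracket_mult_mult[of m f] P2.bracket_mult_mult[of m f] f
    by (simp add: cochain2_add bracket_add_left cochains_add bracket_w_add add.commute)
  then show ?thesis
    by (simp add: eq_neg_iff_add_eq_0)
qed

text \<open>Polarization again: the identity for the sum pair minus those for the two pairs leaves
  the mixed terms.\<close>

lemma bracket_w_D:
  assumes f: "f \<in> cochains (m + 1)"
  shows "bracket (m + 1) 0 (bracket 1 m w2 f) D1 + bracket (m + 1) 0 (bracket 1 m w1 f) D2 =
    bracket 1 m w2 (bracket m 0 f D1) + bracket 1 m w1 (bracket m 0 f D2)"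
proof -
  interpret S: AssDer_pair scale "\<lambda>x y. \<mu>1 x y + \<mu>2 x y" "\<lambda>x. \<delta>1 x + \<delta>2 x"
    by (rule sum_AssDer_pair)
  have w: "bracket 1 m w1 f \<in> cochains ((m + 1) + 1)" "bracket 1 m w2 f \<in> cochains ((m + 1) + 1)"
    using bracket_w_cochains[OF f] by simp_all
  have w': "bracket 1 m w1 f + bracket 1 m w2 f \<in> cochains ((m + 1) + 1)"
    using w by (rule cochains_add)
  have K: "bracket m 0 f D1 + bracket m 0 f D2 \<in> cochains (m + 1)"
    using bracket_D_cochains[OF f] by (rule cochains_add)
  show ?thesis
    using S.bracket_mult_der[OF f] P1.bracket_mult_der[OF f] P2.bracket_mult_der[OF f]
    by (simp add: cochain2_add cochain1_add bracket_add_left[OF f] bracket_add_left[OF K]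
        bracket_add_right[OF f] bracket_add_right[OF w', simplified] bracket_w_add bracket_D_add algebra_simps)
qed

section \<open>The differential and its square\<close>

lemma CAD_cochainsD:
  assumes "c \<in> CAD_cochains (k + 1)"
  shows "fst (c i) \<in> cochains (k + 1)" "snd (c i) \<in> cochains k" "k = 0 \<Longrightarrow> snd (c i) = 0"
    "i \<notin> {1..k + 1} \<Longrightarrow> c i = 0"
  using assms
  by (cases "i \<in> {1..k + 1}"; force simp: CAD_cochains_def AssDer_cochains_def split: if_splits)+

text \<open>
  Since \<open>c 0 = 0\<close> and \<open>c (k + 2) = 0\<close>, the boundary entries and the case \<open>k = 0\<close>, where the truncated
  \<open>k - 1\<close> only meets \<open>g = 0\<close>, obey the same formula as the inner entries.
\<close>

lemma d_CAD_eq: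
  assumes c: "c \<in> CAD_cochains (k + 1)"
  defines "f \<equiv> \<lambda>i. fst (c i)" and "g \<equiv> \<lambda>i. snd (c i)"
  shows "d_CAD (k + 1) c i =
    (cscale ((-1) ^ k) (bracket 1 k w2 (f (i - 1)) + bracket 1 k w1 (f i)),
     cscale (- ((-1) ^ k)) (bracket 1 (k - 1) w2 (g (i - 1)) + bracket 1 (k - 1) w1 (g i)
       + bracket k 0 (f (i - 1)) D2 + bracket k 0 (f i) D1))"
proof -
  \<comment> \<open>For \<open>i = 0\<close> the truncated \<open>i - 1\<close> is \<open>0\<close>
    again, and for \<open>i > k + 2\<close> both indices exceed \<open>k + 1\<close>, so the uniform
    formula gives 0 there too.\<close>
  have z: "f i = 0" "g i = 0" if "i = 0 \<or> i > k + 1" for i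
    using CAD_cochainsD(4)[OF c, of i] that by (auto simp: f_def g_def)
  have g0: "k = 0 \<Longrightarrow> g i = 0" for i
    using CAD_cochainsD(3)[OF c] by (simp add: g_def)
  show ?thesis
  proof (cases "k = 0")
    case True
    consider "i = 0" | "i = 1" | "i = 2" | "i > 2"
      by linarith
    then show ?thesis
      using True z[of 0] z[of "i - 1"] z[of i] z[of 2] g0
      by cases (auto simp: d_CAD_def f_def[symmetric] g_def[symmetric] bracket_w_zero bracket_D_zero
          zero_prod_def cscale_minus)
  next
    case False
    consider "i = 0" | "i = 1" | "2 \<le> i" "i \<le> k + 1" | "i = k + 2" | "i > k + 2"
      by linarith
    then show ?thesis
      using False z[of 0] z[of "i - 1"] z[of i]
      by cases (auto simp: d_CAD_def Let_def f_def[symmetric] g_def[symmetric] bracket_w_zero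
          bracket_D_zero zero_prod_def cscale_minus cscale_add cscale_diff cscale_uminus algebra_simps)
  qed
qed

lemma d_CAD_cochains:
  assumes c: "c \<in> CAD_cochains (k + 1)"
  shows "d_CAD (k + 1) c \<in> CAD_cochains (k + 2)"
proof -
  note C = CAD_cochainsD[OF c]
  \<comment> \<open>For \<open>k = 0\<close> the truncated \<open>k - 1\<close> would predict the
    wrong arity, but then \<open>snd (c i) = 0\<close> and the bracket is 0.\<close>
  have g: "bracket 1 (k - 1) w1 (snd (c i)) \<in> cochains (k + 1)"
    "bracket 1 (k - 1) w2 (snd (c i)) \<in> cochains (k + 1)" for i
    using C(2,3)[of i] bracket_w_cochains[of "snd (c i)" "k - 1"]
    by (cases k; auto simp: bracket_w_zero)+
  have "d_CAD (k + 1) c i \<in> AssDer_cochains (k + 2)" for i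
    unfolding d_CAD_eq[OF c]
    using g bracket_w_cochains[OF C(1)] bracket_D_cochains[OF C(1)]
    by (auto simp: AssDer_cochains_def intro!: cochains_cscale cochains_add)
  moreover have "d_CAD (k + 1) c i = 0" if "i \<notin> {1..k + 2}" for i
  proof -
    have "c i = 0" "c (i - 1) = 0"
      using that by (auto intro!: C(4))
    then show ?thesis
      unfolding d_CAD_eq[OF c] by (simp add: bracket_w_zero bracket_D_zero zero_prod_def)
  qed
  ultimately show ?thesis
    by (simp add: CAD_cochains_def)
qed

lemma d_CAD_d_CAD:
  assumes c: "c \<in> CAD_cochains (k + 1)"
  shows "d_CAD (k + 2) (d_CAD (k + 1) c) = 0"
proof
  fix i :: nat
  define f where "f i = fst (c i)" for i
  define g where "g i = snd (c i)" for i
  define s :: 'k where "s = (-1) ^ k"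
  \<comment> \<open>\<open>T\<close> collects the contribution of the \<open>g\<close> components,
    which involves \<open>k - 1\<close> and thus needs \<open>k = 0\<close> treated apart.\<close>
  define T where "T i = bracket 1 (k - 1) w2 (g (i - 1)) + bracket 1 (k - 1) w1 (g i)" for i
  define d where "d = d_CAD (k + 1) c"
  have f: "f i \<in> cochains (k + 1)" for i
    using CAD_cochainsD(1)[OF c] by (simp add: f_def)
  have d_eq: "d i = (cscale s (bracket 1 k w2 (f (i - 1)) + bracket 1 k w1 (f i)),
      cscale (- s) (T i + bracket k 0 (f (i - 1)) D2 + bracket k 0 (f i) D1))" for i
    unfolding d_def d_CAD_eq[OF c] f_def g_def s_def T_def by simp
  \<comment> \<open>The coefficients of \<open>h (i - 1 - 1)\<close> and \<open>h i\<close> are pure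
    squares; that of \<open>h (i - 1)\<close> is the mixed sum.\<close>
  have ww: "bracket 1 (m + 1) w2 (bracket 1 m w2 (h (i - 1 - 1)) + bracket 1 m w1 (h (i - 1)))
      + bracket 1 (m + 1) w1 (bracket 1 m w2 (h (i - 1)) + bracket 1 m w1 (h i)) = 0"
    if "\<And>i. h i \<in> cochains (m + 1)" for h m
    using that P1.bracket_mult_mult P2.bracket_mult_mult
    by (simp add: bracket_w_add bracket_w_w bracket_w_w[simplified])
  have T: "bracket 1 k w2 (T (i - 1)) + bracket 1 k w1 (T i) = 0"
  proof (cases k)
    case 0
    then have "T i = 0" for i
      using CAD_cochainsD(3)[OF c] by (simp add: T_def g_def bracket_w_zero)
    then show ?thesis
      by (simp add: bracket_w_zero)
  next
    case (Suc m)
    then show ?thesis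
      using ww[of g m] CAD_cochainsD(2)[OF c] by (simp add: T_def g_def)
  qed
  \<comment> \<open>The mixed identity is solved for one term, so that rewriting leaves the other
    \<open>[[w1, f], D2]\<close> terms to cancel.\<close>
  have wD: "bracket (k + 1) 0 (bracket 1 k w1 (f i)) D1 = bracket 1 k w1 (bracket k 0 (f i) D1)"
    "bracket (k + 1) 0 (bracket 1 k w2 (f i)) D2 = bracket 1 k w2 (bracket k 0 (f i) D2)"
    "bracket (k + 1) 0 (bracket 1 k w2 (f i)) D1 = bracket 1 k w2 (bracket k 0 (f i) D1)
      + bracket 1 k w1 (bracket k 0 (f i) D2) - bracket (k + 1) 0 (bracket 1 k w1 (f i)) D2" for i
    using P1.bracket_mult_der[OF f] P2.bracket_mult_der[OF f] bracket_w_D[OF f]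
    by (simp_all add: algebra_simps)
  have "fst (d_CAD (k + 2) d i) = cscale (- s) (cscale s
      (bracket 1 (k + 1) w2 (bracket 1 k w2 (f (i - 1 - 1)) + bracket 1 k w1 (f (i - 1)))
      + bracket 1 (k + 1) w1 (bracket 1 k w2 (f (i - 1)) + bracket 1 k w1 (f i))))"
    using d_CAD_eq[of d "k + 1" i] d_CAD_cochains[OF c, folded d_def]
    by (simp add: d_eq s_def cscale_add bracket_w_add bracket_w_cscale)
  also have "\<dots> = 0"
    using ww[of f k] f by simp
  finally have 1: "fst (d_CAD (k + 2) d i) = 0" .
  \<comment> \<open>The outer sign is \<open>- ((-1) ^ (k + 1))\<close>, which equals
    \<open>s\<close>.\<close>
  have "snd (d_CAD (k + 2) d i) = cscale s
      (bracket 1 k w2 (cscale (- s) (T (i - 1) + bracket k 0 (f (i - 1 - 1)) D2 + bracket k 0 (f (i - 1)) D1))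
      + bracket 1 k w1 (cscale (- s) (T i + bracket k 0 (f (i - 1)) D2 + bracket k 0 (f i) D1))
      + bracket (k + 1) 0 (cscale s (bracket 1 k w2 (f (i - 1 - 1)) + bracket 1 k w1 (f (i - 1)))) D2
      + bracket (k + 1) 0 (cscale s (bracket 1 k w2 (f (i - 1)) + bracket 1 k w1 (f i))) D1)"
    using d_CAD_eq[of d "k + 1" i] d_CAD_cochains[OF c, folded d_def]
    by (simp add: d_eq s_def)
  \<comment> \<open>The terms \<open>[w, [f, D]]\<close> carry the inner factor \<open>- s\<close>
    and the terms \<open>[[w, f], D]\<close> the factor \<open>s\<close>; by \<open>wD\<close> they
    cancel and only the \<open>T\<close> part remains.\<close>
  also have "\<dots> = cscale s (cscale (- s) (bracket 1 k w2 (T (i - 1)) + bracket 1 k w1 (T i)))"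
    unfolding bracket_w_cscale bracket_D_cscale bracket_w_add bracket_D_add cscale_add wD
    by (simp add: cscale_minus cscale_uminus cscale_diff cscale_add algebra_simps)
  also have "\<dots> = 0"
    by (simp only: T cscale_zero)
  finally show "d_CAD (k + 2) (d_CAD (k + 1) c) i = 0 i"
    using 1 by (simp add: prod_eq_iff d_def)
qed

end

theorem theorem5p2:
  fixes scale :: "'k::field_char_0 \<Rightarrow> 'a::ab_group_add \<Rightarrow> 'a"
    and \<mu>1 \<mu>2 :: "'a \<Rightarrow> 'a \<Rightarrow> 'a"
    and \<delta>1 \<delta>2 :: "'a \<Rightarrow> 'a"
  assumes "compatible_AssDer_pair scale \<mu>1 \<mu>2 \<delta>1 \<delta>2"
  shows "\<forall>n\<ge>1. \<forall>c \<in> char0_vector_space.CAD_cochains scale n.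
     compatible_AssDer_pair.d_CAD scale \<mu>1 \<mu>2 \<delta>1 \<delta>2 n c
       \<in> char0_vector_space.CAD_cochains scale (n + 1) \<and>
     compatible_AssDer_pair.d_CAD scale \<mu>1 \<mu>2 \<delta>1 \<delta>2 (n + 1)
       (compatible_AssDer_pair.d_CAD scale \<mu>1 \<mu>2 \<delta>1 \<delta>2 n c) = 0"
proof (intro allI impI ballI)
  interpret compatible_AssDer_pair scale \<mu>1 \<mu>2 \<delta>1 \<delta>2
    by (rule assms)
  fix n :: nat and c
  assume "1 \<le> n" and c: "c \<in> CAD_cochains n"
  then obtain k where "n = k + 1"
    by (metis add.commute le_Suc_ex)
  then show "d_CAD n c \<in> CAD_cochains (n + 1) \<and> d_CAD (n + 1) (d_CAD n c) = 0"
    using c d_CAD_cochains[of c k] d_CAD_d_CAD[of c k] by simp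
qed

end
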